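(* Let $K=\mathbb{Q}(\sqrt{D})$ be a real quadratic field, regarded as a subfield of $\mathbb{R}$ via a fixed embedding. Then the set $M(\mathbb{T}_K)\cap K$ is dense in the inhomogeneous spectrum $M(\mathbb{T}_K)\subseteq\mathbb{R}$.
   Context: $D>1$ is a square-free integer, $K=\mathbb{Q}(\sqrt D)$ is regarded as a subfield of $\mathbb{R}$ via a fixed embedding, $\mathcal{O}_K$ is its ring of integers, and $a\mapsto\overline a$ is Galois conjugation. Let $V_K=K\otimes_{\mathbb{Q}}\mathbb{R}$, identified with $\mathbb{R}\times\mathbb{R}$ as an $\mathbb{R}$-algebra by $a\otimes 1\mapsto(\overline a,a)$; the resulting coordinates are denoted $(s,u)$. The ring $\mathcal{O}_K$ embeds as the lattice $\{(\overline a,a): a\in\mathcal{O}_K\}$ in $V_K$, and $\mathbb{T}_K=V_K/\mathcal{O}_K$ is the quotient torus. The absolute norm is $\mathbf{N}(s,u)=|su|$ on $V_K$ (extending $a\mapsto|a\overline a|$ on $K$). For $P\in V_K$ put $M(P)=\inf_{Q\in\mathcal{O}_K}\mathbf{N}(P-Q)$; this is $\mathcal{O}_K$-invariant and so defines a function $M:\mathbb{T}_K\to\mathbb{R}$. The inhomogeneous spectrum of $K$ is the image $M(\mathbb{T}_K)$. *)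

theory Defs
  imports
    "HOL-Analysis.Analysis"
    "HOL-Computational_Algebra.Computational_Algebra"
begin

(* K = Q(sqrt D) inside the reals.  Both embeddings of K into the reals have this image and
   induce the same conjugation on it, so taking the positive square root loses nothing. *)
definition quad_field :: "int \<Rightarrow> real set" where
  "quad_field D = {a + b * sqrt (of_int D) | a b. a \<in> \<rat> \<and> b \<in> \<rat>}"

definition ring_of_ints :: "int \<Rightarrow> real set" where
  "ring_of_ints D = {x \<in> quad_field D. algebraic_int x}"

(* Meaningful only for D not a perfect square and x in quad_field D, where the
   coefficients a and b are determined by x. *)
definition gal_conj :: "int \<Rightarrow> real \<Rightarrow> real" where
  "gal_conj D x = (THE y. \<exists>a\<in>\<rat>. \<exists>b\<in>\<rat>.
     x = a + b * sqrt (of_int D) \<and> y = a - b * sqrt (of_int D))"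

(* V_K is the type real \<times> real, with coordinates (s, u) such that a in K has
   s-coordinate its conjugate and u-coordinate a itself. *)
definition int_lattice :: "int \<Rightarrow> (real \<times> real) set" where
  "int_lattice D = (\<lambda>a. (gal_conj D a, a)) ` ring_of_ints D"

definition abs_norm :: "real \<times> real \<Rightarrow> real" where
  "abs_norm P = \<bar>fst P * snd P\<bar>"

definition inhom_min :: "int \<Rightarrow> real \<times> real \<Rightarrow> real" where
  "inhom_min D P = (INF Q \<in> int_lattice D. abs_norm (P - Q))"

definition quad_torus :: "int \<Rightarrow> (real \<times> real) set set" where
  "quad_torus D = UNIV // {(P, Q). P - Q \<in> int_lattice D}"

(* inhom_min D is constant on each class C of the torus, so inhom_min D ` C is a singleton. *)
definition torus_min :: "int \<Rightarrow> (real \<times> real) set \<Rightarrow> real" where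
  "torus_min D C = the_elem (inhom_min D ` C)"

definition inhom_spectrum :: "int \<Rightarrow> real set" where
  "inhom_spectrum D = torus_min D ` quad_torus D"

end

theory Submission
  imports Defs
begin

text \<open>A unit \<open>e > 1\<close> of norm 1 acts on the torus by the hyperbolic map
  \<open>T (s, u) = (e\<^sup>-\<^sup>1 s, e u)\<close>, which preserves the norm and hence \<open>M\<close>. By applying a power of
  \<open>T\<close>, any lattice point that nearly realises \<open>M(P)\<close> can be brought to within bounded distance of
  the orbit of \<open>P\<close>. So if the orbit of \<open>P'\<close> stays within \<open>\<eta>\<close> of the orbit of \<open>P\<close>, then
  \<open>M(P') \<ge> M(P) - O(\<eta>)\<close>. The reverse estimate for \<open>P'\<close> close to \<open>P\<close> is the upper semicontinuity
  of \<open>M\<close>.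

  The forward orbit of \<open>P = (s, u)\<close> has a close return. Replacing \<open>u\<close> by a nearby \<open>u' \<in> K\<close> makes
  the unstable coordinate return exactly, so that the forward orbit of \<open>(s, u')\<close> keeps following the
  loop that the orbit of \<open>P\<close> almost closes. Swapping the coordinates treats \<open>s\<close> in the same way,
  and \<open>M(P)\<close> is approximated by values at points of \<open>K \<times> K\<close>.

  At a point of \<open>K \<times> K\<close> the infimum either is attained, and then lies in \<open>K\<close>, or is approached
  along the two ends of the orbit. These are asymptotic to the orbits of points of \<open>K\<close>, whose norms
  from the lattice lie in \<open>d\<^sup>-\<^sup>2\<int>\<close> for some \<open>d\<close>; the infimum is then rational.\<close>

section \<open>Real estimates and the irrationality of the square root\<close>

lemma powi_floor_log:
  fixes b x :: real
  assumes "b > 1" "x > 0"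
  shows "b powi \<lfloor>log b x\<rfloor> \<le> x" "x < b powi (\<lfloor>log b x\<rfloor> + 1)"
proof -
  have powi: "b powi m = b powr of_int m" for m
    using assms by (simp add: powr_real_of_int')
  show "b powi \<lfloor>log b x\<rfloor> \<le> x"
    unfolding powi using assms by (subst le_log_iff[symmetric]) auto
  show "x < b powi (\<lfloor>log b x\<rfloor> + 1)"
    unfolding powi using assms by (subst log_less_iff[symmetric]) linarith+
qed

text \<open>The error depends only on the box size \<open>R\<close> and on \<eta>; it becomes the
  loss in \<open>shadowing_lower_bound\<close>.\<close>

lemma abs_mult_perturb:
  fixes a b :: real
  assumes "\<bar>a\<bar> \<le> R" "\<bar>b\<bar> \<le> R" "\<bar>a - a'\<bar> \<le> \<eta>" "\<bar>b - b'\<bar> \<le> \<eta>"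
  shows "\<bar>a' * b'\<bar> \<le> \<bar>a * b\<bar> + (2 * R * \<eta> + \<eta>\<^sup>2)"
proof -
  have "a' * b' = a * b - a * (b - b') - (a - a') * b + (a - a') * (b - b')"
    by (simp add: algebra_simps)
  moreover have "\<bar>a * (b - b')\<bar> \<le> R * \<eta>" "\<bar>(a - a') * b\<bar> \<le> \<eta> * R"
    "\<bar>(a - a') * (b - b')\<bar> \<le> \<eta> * \<eta>"
    unfolding abs_mult using assms by (intro mult_mono; linarith)+
  ultimately show ?thesis
    by (simp add: power2_eq_square mult.commute[of \<eta> R])
qed

text \<open>The root is an algebraic integer; if rational, it is an integer and \<open>D\<close> is
  its square.\<close>

lemma sqrt_squarefree_irrational:
  fixes D :: int
  assumes "D > 1" "squarefree D"
  shows "sqrt (of_int D) \<notin> \<rat>"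
proof
  assume "sqrt (of_int D) \<in> \<rat>"
  then have "sqrt (of_int D) \<in> \<int>"
    by (intro rational_algebraic_int_is_int) auto
  then obtain k where k: "sqrt (of_int D) = of_int k"
    by (elim Ints_cases)
  have "real_of_int D = (sqrt (of_int D))\<^sup>2"
    using assms by simp
  then have "D = k\<^sup>2"
    unfolding k by (metis of_int_eq_iff of_int_power)
  then have "is_unit k"
    using assms(2) by (auto simp: squarefree_def)
  then have "D = 1"
    using \<open>D = k\<^sup>2\<close> by (auto simp: zdvd1_eq power2_eq_1_iff)
  then show False
    using assms by simp
qed

section \<open>The field and its ring of integers\<close>

locale real_quadratic =
  fixes D :: int
  assumes pos: "D > 0" and irrational: "sqrt (of_int D) \<notin> \<rat>"
begin

abbreviation w :: real where "w \<equiv> sqrt (of_int D)"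
abbreviation K :: "real set" where "K \<equiv> quad_field D"
abbreviation conj :: "real \<Rightarrow> real" where "conj \<equiv> gal_conj D"
abbreviation O_K :: "real set" where "O_K \<equiv> ring_of_ints D"

text \<open>The order Z[w], possibly smaller than \<open>O_K\<close>. It supplies denominators, the
  unit and the covering bound.\<close>

definition Z_w :: "real set" where
  "Z_w = {of_int a + of_int b * w | a b. True}"

lemma w_pos: "w > 0"
  using pos by simp

lemma w_square: "w * w = of_int D"
  using pos by simp

text \<open>Irrationality of \<open>w\<close> makes the coefficients unique, on which the
  description operator in \<open>gal_conj\<close> relies.\<close>

lemma rat_coeffs_eq:
  assumes "a \<in> \<rat>" "b \<in> \<rat>" "a' \<in> \<rat>" "b' \<in> \<rat>" "a + b * w = a' + b' * w"
  shows "a = a'" "b = b'"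
proof -
  show "b = b'"
  proof (rule ccontr)
    assume "b \<noteq> b'"
    then have "w = (a' - a) / (b - b')"
      using assms(5) by (simp add: field_simps)
    then show False
      using irrational assms by (metis Rats_diff Rats_divide)
  qed
  then show "a = a'"
    using assms(5) by simp
qed

lemma conj_eq:
  assumes "a \<in> \<rat>" "b \<in> \<rat>"
  shows "conj (a + b * w) = a - b * w"
  unfolding gal_conj_def
proof (rule the_equality)
  show "\<exists>aa\<in>\<rat>. \<exists>ba\<in>\<rat>. a + b * w = aa + ba * w \<and> a - b * w = aa - ba * w"
    using assms by blast
next
  fix y
  assume "\<exists>aa\<in>\<rat>. \<exists>ba\<in>\<rat>. a + b * w = aa + ba * w \<and> y = aa - ba * w"
  then show "y = a - b * w"
    using rat_coeffs_eq assms by metis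
qed

lemma KE:
  assumes "x \<in> K"
  obtains a b where "a \<in> \<rat>" "b \<in> \<rat>" "x = a + b * w" "conj x = a - b * w"
  using assms conj_eq unfolding quad_field_def by blast

lemma KI: "a \<in> \<rat> \<Longrightarrow> b \<in> \<rat> \<Longrightarrow> a + b * w \<in> K"
  unfolding quad_field_def by blast

lemma Rats_in_K: "a \<in> \<rat> \<Longrightarrow> a \<in> K"
  using KI[of a 0] by simp

lemma conj_Rats: "a \<in> \<rat> \<Longrightarrow> conj a = a"
  using conj_eq[of a 0] by simp

lemma K_add: "x \<in> K \<Longrightarrow> y \<in> K \<Longrightarrow> x + y \<in> K"
  and conj_add: "x \<in> K \<Longrightarrow> y \<in> K \<Longrightarrow> conj (x + y) = conj x + conj y"
proof -
  assume "x \<in> K" "y \<in> K"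
  then obtain a b c d where ab: "a \<in> \<rat>" "b \<in> \<rat>" "x = a + b * w" "conj x = a - b * w"
    and cd: "c \<in> \<rat>" "d \<in> \<rat>" "y = c + d * w" "conj y = c - d * w"
    by (metis KE)
  have *: "x + y = (a + c) + (b + d) * w"
    using ab cd by (simp add: algebra_simps)
  then show "x + y \<in> K"
    using ab cd by (simp only: * KI Rats_add)
  have rat: "a + c \<in> \<rat>" "b + d \<in> \<rat>"
    using ab cd by auto
  show "conj (x + y) = conj x + conj y"
    unfolding * conj_eq[OF rat] ab(4) cd(4) by (simp add: algebra_simps)
qed

lemma K_mult: "x \<in> K \<Longrightarrow> y \<in> K \<Longrightarrow> x * y \<in> K"
  and conj_mult: "x \<in> K \<Longrightarrow> y \<in> K \<Longrightarrow> conj (x * y) = conj x * conj y"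
proof -
  assume "x \<in> K" "y \<in> K"
  then obtain a b c d where ab: "a \<in> \<rat>" "b \<in> \<rat>" "x = a + b * w" "conj x = a - b * w"
    and cd: "c \<in> \<rat>" "d \<in> \<rat>" "y = c + d * w" "conj y = c - d * w"
    by (metis KE)
  have "x * y = (a * c + b * d * (w * w)) + (a * d + b * c) * w"
    unfolding ab(3) cd(3) by (simp only: algebra_simps)
  then have *: "x * y = (a * c + b * d * of_int D) + (a * d + b * c) * w"
    unfolding w_square .
  have "conj x * conj y = (a * c + b * d * (w * w)) - (a * d + b * c) * w"
    unfolding ab(4) cd(4) by (simp only: algebra_simps)
  then have **: "conj x * conj y = (a * c + b * d * of_int D) - (a * d + b * c) * w"
    unfolding w_square .
  have rat: "a * c + b * d * of_int D \<in> \<rat>" "a * d + b * c \<in> \<rat>"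
    using ab cd by auto
  then show "x * y \<in> K"
    by (simp only: * KI)
  show "conj (x * y) = conj x * conj y"
    unfolding * ** conj_eq[OF rat] ..
qed

lemma K_conj: "x \<in> K \<Longrightarrow> conj x \<in> K"
  and conj_conj: "x \<in> K \<Longrightarrow> conj (conj x) = x"
proof -
  assume "x \<in> K"
  then obtain a b where ab: "a \<in> \<rat>" "b \<in> \<rat>" "x = a + b * w" "conj x = a - b * w"
    by (metis KE)
  have *: "conj x = a + (-b) * w"
    using ab by simp
  show "conj x \<in> K"
    unfolding * using ab by (intro KI) auto
  show "conj (conj x) = x"
    unfolding * using ab by (subst conj_eq) auto
qed

lemma K_uminus: "x \<in> K \<Longrightarrow> - x \<in> K"
  using K_mult[of "-1" x] Rats_in_K[of "-1"] by simp

lemma conj_uminus: "x \<in> K \<Longrightarrow> conj (- x) = - conj x"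
  using conj_mult[of "-1" x] Rats_in_K[of "-1"] conj_Rats[of "-1"] by simp

lemma K_diff: "x \<in> K \<Longrightarrow> y \<in> K \<Longrightarrow> x - y \<in> K"
  using K_add[of x "-y"] K_uminus by simp

lemma conj_diff: "x \<in> K \<Longrightarrow> y \<in> K \<Longrightarrow> conj (x - y) = conj x - conj y"
  using conj_add[of x "-y"] K_uminus conj_uminus by simp

lemma K_abs: "x \<in> K \<Longrightarrow> \<bar>x\<bar> \<in> K"
  using K_uminus by (simp add: abs_if)

lemma K_power: "x \<in> K \<Longrightarrow> x ^ n \<in> K"
  by (induction n) (auto intro: K_mult Rats_in_K)

lemma conj_power: "x \<in> K \<Longrightarrow> conj (x ^ n) = conj x ^ n"
  by (induction n) (auto simp: conj_mult K_power conj_Rats)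

lemma norm_in_Rats: "x \<in> K \<Longrightarrow> x * conj x \<in> \<rat>"
proof -
  assume "x \<in> K"
  then obtain a b where ab: "a \<in> \<rat>" "b \<in> \<rat>" "x = a + b * w" "conj x = a - b * w"
    by (metis KE)
  have "x * conj x = a * a - b * b * (w * w)"
    unfolding ab(4) unfolding ab(3) by (simp add: algebra_simps)
  also have "\<dots> \<in> \<rat>"
    unfolding w_square using ab by auto
  finally show ?thesis .
qed

lemma trace_in_Rats: "x \<in> K \<Longrightarrow> x + conj x \<in> \<rat>"
  by (elim KE) auto

lemma conj_eq_0_iff: "x \<in> K \<Longrightarrow> conj x = 0 \<longleftrightarrow> x = 0"
  using conj_conj conj_Rats[of 0] by (metis Rats_0)

lemma K_inverse: "x \<in> K \<Longrightarrow> inverse x \<in> K"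
proof (cases "x = 0")
  case False
  assume x: "x \<in> K"
  then have "inverse x = inverse (x * conj x) * conj x"
    using False conj_eq_0_iff by (simp add: field_simps)
  then show ?thesis
    using x norm_in_Rats K_mult K_conj Rats_in_K Rats_inverse by metis
qed auto

lemma K_divide: "x \<in> K \<Longrightarrow> y \<in> K \<Longrightarrow> x / y \<in> K"
  using K_mult K_inverse by (simp add: divide_inverse)

section \<open>The order Z[w] and integrality\<close>

lemma Z_wI: "of_int a + of_int b * w \<in> Z_w"
  unfolding Z_w_def by blast

lemma Z_wE:
  assumes "x \<in> Z_w"
  obtains a b :: int where "x = of_int a + of_int b * w"
  using assms unfolding Z_w_def by blast

lemma Z_w_subset_K: "Z_w \<subseteq> K"
  unfolding Z_w_def using KI by auto

lemma Z_w_of_int: "of_int a \<in> Z_w"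
  using Z_wI[of a 0] by simp

lemma Z_w_add: "x \<in> Z_w \<Longrightarrow> y \<in> Z_w \<Longrightarrow> x + y \<in> Z_w"
proof -
  assume "x \<in> Z_w" "y \<in> Z_w"
  then obtain a b c d :: int where "x = of_int a + of_int b * w" "y = of_int c + of_int d * w"
    by (metis Z_wE)
  then have "x + y = of_int (a + c) + of_int (b + d) * w"
    by (simp add: algebra_simps)
  then show ?thesis
    by (simp only: Z_wI)
qed

lemma Z_w_mult: "x \<in> Z_w \<Longrightarrow> y \<in> Z_w \<Longrightarrow> x * y \<in> Z_w"
proof -
  assume "x \<in> Z_w" "y \<in> Z_w"
  then obtain a b c d :: int where xy: "x = of_int a + of_int b * w" "y = of_int c + of_int d * w"
    by (metis Z_wE)
  have "x * y = of_int a * of_int c + of_int b * of_int d * (w * w)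
      + (of_int a * of_int d + of_int b * of_int c) * w"
    unfolding xy by (simp only: algebra_simps)
  also have "\<dots> = of_int (a * c + b * d * D) + of_int (a * d + b * c) * w"
    unfolding w_square by simp
  finally show ?thesis
    by (simp only: Z_wI)
qed

lemma Z_w_conj: "x \<in> Z_w \<Longrightarrow> conj x \<in> Z_w"
  by (elim Z_wE) (use conj_eq Z_wI[of _ "- b" for b] in auto)

lemma Z_w_uminus: "x \<in> Z_w \<Longrightarrow> - x \<in> Z_w"
  using Z_w_mult[OF Z_w_of_int[of "-1"]] by simp

lemma Z_w_power: "x \<in> Z_w \<Longrightarrow> x ^ n \<in> Z_w"
  using Z_w_of_int[of 1] by (induction n) (auto intro: Z_w_mult)

lemma Z_w_sum: "(\<And>i. i \<in> A \<Longrightarrow> f i \<in> Z_w) \<Longrightarrow> sum f A \<in> Z_w"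
  using Z_w_of_int[of 0] by (induction A rule: infinite_finite_induct) (auto intro: Z_w_add)

lemma Z_w_Rats: "x \<in> Z_w \<Longrightarrow> x \<in> \<rat> \<Longrightarrow> x \<in> \<int>"
proof -
  assume "x \<in> Z_w" "x \<in> \<rat>"
  then obtain a b :: int where ab: "x = of_int a + of_int b * w"
    by (metis Z_wE)
  then have "x = of_int a"
    using rat_coeffs_eq[of x 0 "of_int a" "of_int b"] \<open>x \<in> \<rat>\<close> by simp
  then show ?thesis
    by simp
qed

lemma K_denominator:
  assumes "x \<in> K"
  obtains d :: int where "d > 0" "of_int d * x \<in> Z_w"
proof -
  obtain a b where ab: "a \<in> \<rat>" "b \<in> \<rat>" "x = a + b * w"
    using assms by (metis KE)
  obtain p q where pq: "q > 0" "a = of_int p / of_int q"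
    using Rats_cases'[OF ab(1)] by blast
  obtain r t where rt: "t > 0" "b = of_int r / of_int t"
    using Rats_cases'[OF ab(2)] by blast
  have "of_int (q * t) * x = of_int (p * t) + of_int (r * q) * w"
    unfolding ab pq rt using pq rt by (simp add: field_simps)
  then have "of_int (q * t) * x \<in> Z_w"
    by (simp only: Z_wI)
  then show ?thesis
    using pq rt that[of "q * t"] by simp
qed

text \<open>Over the Noetherian ring \<open>\<int>[w]\<close>, the following notion agrees with integrality. Unlike
  the latter it is visibly stable under sums, products and conjugation.\<close>

definition almost_integral :: "real \<Rightarrow> bool" where
  "almost_integral x \<longleftrightarrow> (\<exists>d::int. d > 0 \<and> (\<forall>n. of_int d * x ^ n \<in> Z_w))"

text \<open>The monic equation of degree \<open>m\<close> reduces every higher power of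
  \<open>x\<close> to lower ones, so \<open>r ^ m\<close>, a common denominator of the powers below
  \<open>m\<close>, serves for all of them.\<close>

lemma algebraic_int_imp_almost_integral:
  assumes "x \<in> K" "algebraic_int x"
  shows "almost_integral x"
proof -
  obtain p where p: "lead_coeff p = 1" "\<forall>i. coeff p i \<in> \<int>" "poly p x = 0"
    using assms by (auto elim: algebraic_int.cases)
  obtain r :: int where r: "r > 0" "of_int r * x \<in> Z_w"
    using K_denominator assms by blast
  define m where "m = degree p"
  have eq: "x ^ m = - (\<Sum>i<m. coeff p i * x ^ i)"
  proof -
    have "poly p x = (\<Sum>i<m. coeff p i * x ^ i) + x ^ m"
      using p(1) by (simp add: poly_altdef m_def lessThan_Suc_atMost[symmetric])
    then show ?thesis
      using p(3) by simp
  qed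
  have "of_int (r ^ m) * x ^ n \<in> Z_w" for n
  proof (induction n rule: less_induct)
    case (less n)
    show ?case
    proof (cases "n < m")
      case True
      then have "r ^ m = r ^ (m - n) * r ^ n"
        by (simp flip: power_add)
      then have "of_int (r ^ m) * x ^ n = of_int (r ^ (m - n)) * (of_int r * x) ^ n"
        by (simp add: power_mult_distrib)
      then show ?thesis
        using r Z_w_mult Z_w_of_int Z_w_power by metis
    next
      case False
      then have "x ^ n = x ^ m * x ^ (n - m)"
        by (simp flip: power_add)
      also have "\<dots> = (\<Sum>i<m. - coeff p i * x ^ (i + (n - m)))"
        unfolding eq by (simp add: sum_distrib_left power_add sum_negf algebra_simps)
      finally have "of_int (r ^ m) * x ^ n =
          (\<Sum>i<m. - coeff p i * (of_int (r ^ m) * x ^ (i + (n - m))))"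
        by (simp add: sum_distrib_left algebra_simps)
      also have "\<dots> \<in> Z_w"
      proof (rule Z_w_sum)
        fix i assume "i \<in> {..<m}"
        then have "of_int (r ^ m) * x ^ (i + (n - m)) \<in> Z_w"
          using less False by simp
        moreover have "- coeff p i \<in> Z_w"
          using p(2) Z_w_of_int Z_w_uminus by (metis Ints_cases)
        ultimately show "- coeff p i * (of_int (r ^ m) * x ^ (i + (n - m))) \<in> Z_w"
          by (rule Z_w_mult[rotated])
      qed
      finally show ?thesis .
    qed
  qed
  then show ?thesis
    unfolding almost_integral_def using r by (metis zero_less_power)
qed

lemma almost_integral_add:
  assumes "almost_integral x" "almost_integral y"
  shows "almost_integral (x + y)"
proof -
  obtain d e :: int where de: "d > 0" "e > 0" "\<And>n. of_int d * x ^ n \<in> Z_w" "\<And>n. of_int e * y ^ n \<in> Z_w"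
    using assms unfolding almost_integral_def by blast
  have "of_int (d * e) * (x + y) ^ n \<in> Z_w" for n
  proof -
    have "of_int (d * e) * (x + y) ^ n =
        (\<Sum>k\<le>n. of_int (int (n choose k)) * ((of_int d * x ^ k) * (of_int e * y ^ (n - k))))"
      by (simp add: binomial_ring sum_distrib_left algebra_simps)
    also have "\<dots> \<in> Z_w"
      by (intro Z_w_sum Z_w_mult[OF Z_w_of_int] Z_w_mult[OF de(3,4)])
    finally show ?thesis .
  qed
  then show ?thesis
    unfolding almost_integral_def using de by (metis mult_pos_pos)
qed

lemma almost_integral_mult:
  assumes "almost_integral x" "almost_integral y"
  shows "almost_integral (x * y)"
proof -
  obtain d e :: int where de: "d > 0" "e > 0" "\<And>n. of_int d * x ^ n \<in> Z_w" "\<And>n. of_int e * y ^ n \<in> Z_w"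
    using assms unfolding almost_integral_def by blast
  have "of_int (d * e) * (x * y) ^ n \<in> Z_w" for n
    using Z_w_mult[OF de(3,4), of n n] by (simp add: power_mult_distrib algebra_simps)
  then show ?thesis
    unfolding almost_integral_def using de by (metis mult_pos_pos)
qed

lemma almost_integral_conj:
  assumes "x \<in> K" "almost_integral x"
  shows "almost_integral (conj x)"
proof -
  obtain d :: int where d: "d > 0" "\<And>n. of_int d * x ^ n \<in> Z_w"
    using assms unfolding almost_integral_def by blast
  have "of_int d * conj x ^ n \<in> Z_w" for n
    using Z_w_conj[OF d(2), of n] assms
    by (simp add: conj_mult conj_power conj_Rats Rats_in_K K_power)
  then show ?thesis
    unfolding almost_integral_def using d by blast
qed

text \<open>All powers of the reduced denominator \<open>q\<close> divide the fixed integer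
  \<open>d\<close>, which leaves only \<open>q = 1\<close>.\<close>

lemma almost_integral_Rats:
  assumes "x \<in> \<rat>" "almost_integral x"
  shows "x \<in> \<int>"
proof -
  obtain d :: int where d: "d > 0" "\<And>n. of_int d * x ^ n \<in> Z_w"
    using assms unfolding almost_integral_def by blast
  obtain p q where pq: "q > 0" "coprime p q" "x = of_int p / of_int q"
    using Rats_cases'[OF assms(1)] by blast
  have dvd: "q ^ n dvd d" for n
  proof -
    have "of_int d * x ^ n \<in> \<int>"
      using Z_w_Rats d(2) assms(1) by (simp add: Rats_power)
    then obtain k where "of_int d * x ^ n = of_int k"
      by (metis Ints_cases)
    then have "real_of_int (d * p ^ n) = of_int (k * q ^ n)"
      using pq by (simp add: field_simps power_divide)
    then have "q ^ n dvd d * p ^ n"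
      by (metis dvd_triv_right of_int_eq_iff)
    then show ?thesis
      using pq(2) by (simp add: coprime_commute coprime_dvd_mult_left_iff)
  qed
  have "q = 1"
  proof (rule ccontr)
    assume "q \<noteq> 1"
    then have "q \<ge> 2"
      using pq by simp
    have "d < 2 ^ nat d"
      using d(1) less_exp[of "nat d"] by (metis int_nat_eq less_imp_le of_nat_less_iff of_nat_numeral of_nat_power)
    also have "\<dots> \<le> q ^ nat d"
      using \<open>q \<ge> 2\<close> by (intro power_mono) auto
    also have "\<dots> \<le> d"
      using zdvd_imp_le[OF dvd d(1)] .
    finally show False
      by simp
  qed
  then show ?thesis
    using pq by simp
qed

lemma trace_in_Ints: "x \<in> K \<Longrightarrow> almost_integral x \<Longrightarrow> x + conj x \<in> \<int>"
  by (simp add: almost_integral_Rats almost_integral_add almost_integral_conj trace_in_Rats)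

lemma norm_in_Ints: "x \<in> K \<Longrightarrow> almost_integral x \<Longrightarrow> x * conj x \<in> \<int>"
  by (simp add: almost_integral_Rats almost_integral_mult almost_integral_conj norm_in_Rats)

text \<open>An element of \<open>K\<close> is a root of the monic quadratic formed from its trace
  and norm; if it is almost integral, these are integers. The ring properties of \<open>O_K\<close>
  then come from those of \<open>almost_integral\<close>.\<close>

lemma O_K_iff: "x \<in> O_K \<longleftrightarrow> x \<in> K \<and> almost_integral x"
proof -
  have "algebraic_int x" if "x \<in> K" "almost_integral x"
  proof
    let ?p = "[:x * conj x, - (x + conj x), 1:]"
    show "\<forall>i. coeff ?p i \<in> \<int>"
      using Ints_minus[OF trace_in_Ints[OF that]] norm_in_Ints[OF that]
      by (auto simp: coeff_pCons split: nat.splits)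
    show "poly ?p x = 0"
      by (simp add: algebra_simps)
  qed auto
  then show ?thesis
    unfolding ring_of_ints_def using algebraic_int_imp_almost_integral by blast
qed

lemma O_K_in_K: "x \<in> O_K \<Longrightarrow> x \<in> K"
  and O_K_add: "x \<in> O_K \<Longrightarrow> y \<in> O_K \<Longrightarrow> x + y \<in> O_K"
  and O_K_mult: "x \<in> O_K \<Longrightarrow> y \<in> O_K \<Longrightarrow> x * y \<in> O_K"
  and O_K_conj: "x \<in> O_K \<Longrightarrow> conj x \<in> O_K"
  by (auto simp: O_K_iff K_add K_mult K_conj almost_integral_add almost_integral_mult
      almost_integral_conj)

lemma Z_w_in_O_K: "x \<in> Z_w \<Longrightarrow> x \<in> O_K"
proof -
  assume x: "x \<in> Z_w"
  then have "of_int 1 * x ^ n \<in> Z_w" for n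
    using Z_w_power by simp
  then have "almost_integral x"
    unfolding almost_integral_def using zero_less_one by blast
  then show ?thesis
    using x Z_w_subset_K by (auto simp: O_K_iff)
qed

lemma O_K_of_int: "of_int a \<in> O_K"
  using Z_w_of_int Z_w_in_O_K by blast

lemma O_K_uminus: "x \<in> O_K \<Longrightarrow> - x \<in> O_K"
  using O_K_mult[OF O_K_of_int[of "-1"]] by simp

lemma O_K_diff: "x \<in> O_K \<Longrightarrow> y \<in> O_K \<Longrightarrow> x - y \<in> O_K"
  using O_K_add[of x "-y"] O_K_uminus by simp

lemma O_K_power: "x \<in> O_K \<Longrightarrow> x ^ n \<in> O_K"
  using O_K_of_int[of 1] by (induction n) (auto intro: O_K_mult)

lemma w_in_O_K: "w \<in> O_K"
  using Z_wI[of 0 1] Z_w_in_O_K by simp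

text \<open>The traces of \<open>q\<close> and \<open>q * w\<close> are integers that determine
  \<open>q\<close>, and on the box they take finitely many values.\<close>

lemma finite_O_K_box: "finite {q \<in> O_K. \<bar>q\<bar> \<le> R \<and> \<bar>conj q\<bar> \<le> R}"
proof (rule finite_subset)
  define A where "A = {- \<lceil>2 * R\<rceil>..\<lceil>2 * R\<rceil>}"
  define B where "B = {- \<lceil>2 * R * w\<rceil>..\<lceil>2 * R * w\<rceil>}"
  show "finite ((\<lambda>(i, j). (of_int i + of_int j / w) / 2) ` (A \<times> B))"
    unfolding A_def B_def by simp
  show "{q \<in> O_K. \<bar>q\<bar> \<le> R \<and> \<bar>conj q\<bar> \<le> R} \<subseteq> (\<lambda>(i, j). (of_int i + of_int j / w) / 2) ` (A \<times> B)"
  proof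
    fix q assume "q \<in> {q \<in> O_K. \<bar>q\<bar> \<le> R \<and> \<bar>conj q\<bar> \<le> R}"
    then have q: "q \<in> O_K" "\<bar>q\<bar> \<le> R" "\<bar>conj q\<bar> \<le> R"
      by auto
    have cw: "conj w = - w"
      using conj_eq[of 0 1] by simp
    have tr: "x + conj x \<in> \<int>" if "x \<in> O_K" for x
      using trace_in_Ints that O_K_iff by blast
    have "conj (q * w) = - (conj q * w)"
      using conj_mult[of q w] q w_in_O_K O_K_in_K cw by simp
    then obtain i j :: int where i: "q + conj q = of_int i" and j: "q * w - conj q * w = of_int j"
      using tr[OF q(1)] tr[OF O_K_mult[OF q(1) w_in_O_K]] by (auto elim!: Ints_cases)
    have "\<bar>of_int i\<bar> \<le> 2 * R"
      using q unfolding i[symmetric] by linarith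
    then have "i \<in> A"
      unfolding A_def by (auto simp: ceiling_le_iff le_ceiling_iff; linarith)
    have "\<bar>of_int j\<bar> = \<bar>q - conj q\<bar> * w"
      using w_pos unfolding j[symmetric] by (simp add: abs_mult flip: left_diff_distrib)
    also have "\<dots> \<le> 2 * R * w"
      using q w_pos by (intro mult_right_mono) auto
    finally have "j \<in> B"
      unfolding B_def by (auto simp: ceiling_le_iff le_ceiling_iff; linarith)
    have "q = (of_int i + of_int j / w) / 2"
      unfolding i[symmetric] j[symmetric] using w_pos by (simp add: field_simps)
    then show "q \<in> (\<lambda>(i, j). (of_int i + of_int j / w) / 2) ` (A \<times> B)"
      using \<open>i \<in> A\<close> \<open>j \<in> B\<close> by (intro image_eqI[of _ _ "(i, j)"]) auto
  qed
qed

section \<open>Units\<close>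

text \<open>Dirichlet's argument: there are infinitely many good approximations \<open>h / k\<close>
  to \<open>w\<close>, and their norms \<open>h^2 - D k^2\<close> are bounded by \<open>B\<close>.
  Two with the same norm and congruent modulo it have a quotient of norm 1 in Z[w].\<close>

lemma Pell_solution: "\<exists>p q::int. p\<^sup>2 - D * q\<^sup>2 = 1 \<and> q \<noteq> 0"
proof -
  define A where "A = approx_set w"
  have inf: "infinite A"
    using irrational rational_iff_finite_approx_set unfolding A_def by blast
  have A: "k > 0" "coprime h k" "\<bar>w - h / k\<bar> < 1 / (of_int k)\<^sup>2" if "(h, k) \<in> A" for h k
    using that by (auto simp: A_def approx_set_def)
  define N where "N = (\<lambda>(h, k). h\<^sup>2 - D * k\<^sup>2)"
  define g where "g = (\<lambda>hk. (N hk, fst hk mod N hk, snd hk mod N hk))"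
  \<comment> \<open>The product of the bounds \<open>1 / k\<close> for
    \<open>\<bar>h - k * w\<bar>\<close> and \<open>k * (2 * w + 1)\<close> for
    \<open>\<bar>h + k * w\<bar>\<close>, rounded up.\<close>
  define B where "B = \<lceil>2 * w + 1\<rceil>"
  have N0: "N (h, k) \<noteq> 0" if "(h, k) \<in> A" for h k
  proof
    assume "N (h, k) = 0"
    then have "h\<^sup>2 = D * k\<^sup>2"
      by (simp add: N_def)
    then have "(real_of_int h)\<^sup>2 = (of_int k * w)\<^sup>2"
      using w_square by (simp add: power2_eq_square algebra_simps flip: of_int_mult)
    moreover have "of_int k * w > 0"
      using A(1)[OF that] w_pos by simp
    ultimately have "\<bar>of_int h\<bar> = of_int k * w"
      by (metis abs_of_pos power2_eq_iff_nonneg abs_ge_zero power2_abs)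
    then have "w = \<bar>of_int h\<bar> / of_int k"
      using A(1)[OF that] by (simp add: field_simps)
    then show False
      using irrational by (metis Rats_abs_iff Rats_divide Rats_of_int)
  qed
  have N_bound: "\<bar>N (h, k)\<bar> \<le> B" if "(h, k) \<in> A" for h k
  proof -
    have k: "real_of_int k \<ge> 1"
      using A(1)[OF that] by linarith
    have "\<bar>h - k * w\<bar> = \<bar>w - h / k\<bar> * k"
      using k by (simp add: abs_if field_simps)
    also have "\<dots> \<le> 1 / (of_int k)\<^sup>2 * k"
      using A(3)[OF that] k by (intro mult_right_mono) auto
    also have "\<dots> = 1 / k"
      using k by (simp add: power2_eq_square)
    finally have le: "\<bar>h - k * w\<bar> \<le> 1 / k" .
    have "1 / real_of_int k \<le> 1"
      using k by simp
    then have "\<bar>h - k * w\<bar> \<le> k"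
      using le k by linarith
    moreover have "k * w > 0"
      using k w_pos by (intro mult_pos_pos) auto
    ultimately have le': "\<bar>h + k * w\<bar> \<le> k * (2 * w + 1)"
      unfolding distrib_left by linarith
    have "real_of_int \<bar>N (h, k)\<bar> = \<bar>of_int h * of_int h - of_int k * of_int k * (w * w)\<bar>"
      unfolding w_square by (simp add: N_def power2_eq_square algebra_simps)
    also have "\<dots> = \<bar>h - k * w\<bar> * \<bar>h + k * w\<bar>"
      unfolding abs_mult[symmetric] by (simp only: algebra_simps)
    also have "\<dots> \<le> 1 / k * (k * (2 * w + 1))"
      using le le' k by (intro mult_mono) auto
    also have "\<dots> = 2 * w + 1"
      using k by simp
    finally show ?thesis
      unfolding B_def by linarith
  qed
  have "g ` A \<subseteq> {-B..B} \<times> {-B..B} \<times> {-B..B}"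
  proof (rule image_subsetI)
    fix a assume "a \<in> A"
    moreover obtain h k where a: "a = (h, k)"
      by (cases a)
    ultimately have hk: "(h, k) \<in> A"
      by simp
    have "\<bar>x mod N (h, k)\<bar> < \<bar>N (h, k)\<bar>" for x
      using N0[OF hk] by (simp add: abs_mod_less)
    then have "x mod N (h, k) \<in> {-B..B}" for x
      using N_bound[OF hk] by (smt (verit) atLeastAtMost_iff)
    moreover have "N (h, k) \<in> {-B..B}"
      using N_bound[OF hk] by auto
    ultimately show "g a \<in> {-B..B} \<times> {-B..B} \<times> {-B..B}"
      unfolding a g_def by simp
  qed
  then have "finite (g ` A)"
    by (rule finite_subset) auto
  then obtain a where a: "a \<in> A" "infinite {b \<in> A. g b = g a}"
    using pigeonhole_infinite[OF inf] by blast
  obtain b where b: "b \<in> A" "g b = g a" "b \<noteq> a"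
  proof -
    have "\<not> {b \<in> A. g b = g a} \<subseteq> {a}"
      using a(2) finite_subset by blast
    then show ?thesis
      using that by blast
  qed
  obtain h k where hk: "a = (h, k)" by (cases a)
  obtain h' k' where hk': "b = (h', k')" by (cases b)
  define n where "n = N a"
  have n: "n \<noteq> 0" "n = h\<^sup>2 - D * k\<^sup>2" "n = h'\<^sup>2 - D * k'\<^sup>2"
    using N0[of h k] a(1) b(2) by (auto simp: n_def hk hk' g_def N_def)
  have "h mod n = h' mod n" "k mod n = k' mod n"
    using b(2) by (auto simp: g_def hk hk' n_def)
  then obtain r t where rt: "h' = h + n * r" "k' = k + n * t"
    by (metis mod_eqE)
  \<comment> \<open>\<open>p + q w\<close> is \<open>(h' + k' w) (h - k w) / n\<close> up to conjugation, a quotient of two elements of norm \<open>n\<close>.\<close>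
  define p q where "p = 1 + (h * r - D * k * t)" and "q = k * r - h * t"
  have p: "n * p = h * h' - D * k * k'"
  proof -
    have "n * p = n + n * (h * r - D * k * t)"
      unfolding p_def by (simp only: distrib_left mult_1_right)
    also have "\<dots> = h\<^sup>2 - D * k\<^sup>2 + n * (h * r - D * k * t)"
      unfolding n(2)[symmetric] ..
    also have "\<dots> = h * h' - D * k * k'"
      unfolding rt by (simp add: algebra_simps power2_eq_square)
    finally show ?thesis .
  qed
  have q: "n * q = k * h' - h * k'"
    unfolding q_def rt by (simp add: algebra_simps)
  have "n\<^sup>2 * (p\<^sup>2 - D * q\<^sup>2) = (n * p)\<^sup>2 - D * (n * q)\<^sup>2"
    by (simp add: algebra_simps power_mult_distrib)
  also have "\<dots> = (h\<^sup>2 - D * k\<^sup>2) * (h'\<^sup>2 - D * k'\<^sup>2)"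
    unfolding p q by (simp add: algebra_simps power2_eq_square)
  also have "\<dots> = n\<^sup>2"
    unfolding n(2)[symmetric] n(3)[symmetric] by (rule power2_eq_square[symmetric])
  finally have "p\<^sup>2 - D * q\<^sup>2 = 1"
    using n(1) by (metis mult_cancel_left1 power_not_zero)
  \<comment> \<open>If \<open>q = 0\<close>, the two fractions agree, and being reduced with
    positive denominators they are the same pair.\<close>
  moreover have "q \<noteq> 0"
  proof
    assume "q = 0"
    then have eq: "h * k' = h' * k"
      using q by (simp add: mult.commute)
    have *: "coprime h k" "coprime h' k'" "k > 0" "k' > 0"
      using A a(1) b(1) unfolding hk hk' by blast+
    have "\<bar>h\<bar> * \<bar>k'\<bar> = \<bar>h'\<bar> * \<bar>k\<bar>"
      using eq by (metis abs_mult)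
    then have "\<bar>k'\<bar> = \<bar>k\<bar>"
      using coprime_crossproduct_int[OF *(1,2)] by blast
    then have k: "k' = k"
      using * by linarith
    then have "h = h'"
      using eq *(3) by (metis less_irrefl mult_right_cancel)
    then show False
      using b(3) hk hk' k by metis
  qed
  ultimately show ?thesis
    by blast
qed

lemma ex_unit: "\<exists>e > 1. e \<in> O_K \<and> conj e = inverse e"
proof -
  obtain p q :: int where pq: "p\<^sup>2 - D * q\<^sup>2 = 1" "q \<noteq> 0"
    using Pell_solution by blast
  \<comment> \<open>Absolute values keep the norm and make both summands nonnegative, which gives
    \<open>e > 1\<close>.\<close>
  define e where "e = of_int \<bar>p\<bar> + of_int \<bar>q\<bar> * w"
  have conj_e: "conj e = of_int \<bar>p\<bar> - of_int \<bar>q\<bar> * w"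
    unfolding e_def by (rule conj_eq) auto
  have "e * conj e = of_int \<bar>p\<bar> * of_int \<bar>p\<bar> - of_int \<bar>q\<bar> * of_int \<bar>q\<bar> * (w * w)"
    unfolding conj_e unfolding e_def by (simp only: algebra_simps)
  also have "\<dots> = of_int (p\<^sup>2 - D * q\<^sup>2)"
    unfolding w_square by (simp add: power2_eq_square flip: of_int_mult of_int_diff)
  finally have "e * conj e = 1"
    using pq by simp
  moreover have "e > 1"
  proof -
    have "p\<^sup>2 > 0"
      using pq pos by (smt (verit) mult_pos_pos zero_less_power2)
    then have "\<bar>p\<bar> \<ge> 1"
      by auto
    then have "real_of_int \<bar>p\<bar> \<ge> 1"
      by linarith
    moreover have "of_int \<bar>q\<bar> * w > 0"
      using pq w_pos by simp
    ultimately show ?thesis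
      unfolding e_def by linarith
  qed
  moreover have "e \<in> O_K"
    unfolding e_def by (intro Z_w_in_O_K Z_wI)
  ultimately show ?thesis
    by (metis inverse_unique)
qed

section \<open>The inhomogeneous minimum\<close>

lemma inhom_min_eq: "inhom_min D (s, u) = (INF q\<in>O_K. \<bar>(s - conj q) * (u - q)\<bar>)"
  unfolding inhom_min_def int_lattice_def abs_norm_def by (simp add: image_image)

lemma inhom_min_le: "q \<in> O_K \<Longrightarrow> inhom_min D (s, u) \<le> \<bar>(s - conj q) * (u - q)\<bar>"
  unfolding inhom_min_eq by (intro cINF_lower bdd_belowI[of _ 0]) auto

lemma le_inhom_min:
  "(\<And>q. q \<in> O_K \<Longrightarrow> c \<le> \<bar>(s - conj q) * (u - q)\<bar>) \<Longrightarrow> c \<le> inhom_min D (s, u)"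
  unfolding inhom_min_eq using O_K_of_int[of 0] by (intro cINF_greatest) auto

lemma inhom_min_less:
  assumes "inhom_min D (s, u) < c"
  obtains q where "q \<in> O_K" "\<bar>(s - conj q) * (u - q)\<bar> < c"
  using assms le_inhom_min[of c s u] by (meson not_le)

lemma inhom_min_nonneg: "inhom_min D (s, u) \<ge> 0"
  by (rule le_inhom_min) simp

text \<open>Conjugation permutes \<open>O_K\<close> and exchanges the two factors. Results about
  \<open>u\<close> thereby carry over to \<open>s\<close>.\<close>

lemma inhom_min_swap: "inhom_min D (u, s) = inhom_min D (s, u)"
proof -
  have "inhom_min D (s, u) \<le> inhom_min D (u, s)" for s u
  proof (rule le_inhom_min)
    fix q assume "q \<in> O_K"
    then show "inhom_min D (s, u) \<le> \<bar>(u - conj q) * (s - q)\<bar>"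
      using inhom_min_le[of "conj q" s u] O_K_conj conj_conj O_K_in_K by (simp add: mult.commute)
  qed
  then show ?thesis
    by (simp add: antisym)
qed

text \<open>A lattice point nearly optimal at \<open>u\<close> gives almost the same value at nearby
  \<open>u'\<close>, and any single lattice point bounds the infimum from above.\<close>

lemma inhom_min_upper_semicontinuous:
  assumes "\<delta> > 0"
  obtains \<theta> where "\<theta> > 0"
    "\<And>u'. \<bar>u' - u\<bar> < \<theta> \<Longrightarrow> inhom_min D (s, u') < inhom_min D (s, u) + \<delta>"
proof -
  obtain q where q: "q \<in> O_K" "\<bar>(s - conj q) * (u - q)\<bar> < inhom_min D (s, u) + \<delta> / 2"
    using inhom_min_less[of s u "inhom_min D (s, u) + \<delta> / 2"] assms by auto
  define c where "c = \<bar>s - conj q\<bar> + 1"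
  define \<theta> where "\<theta> = \<delta> / 2 / c"
  have c: "c > 0" "\<bar>s - conj q\<bar> \<le> c"
    by (auto simp: c_def)
  then have "\<theta> > 0"
    using assms by (simp add: \<theta>_def)
  moreover have "inhom_min D (s, u') < inhom_min D (s, u) + \<delta>" if "\<bar>u' - u\<bar> < \<theta>" for u'
  proof -
    have "\<bar>(s - conj q) * (u' - u)\<bar> \<le> c * \<theta>"
      unfolding abs_mult using that c by (intro mult_mono) auto
    also have "\<dots> = \<delta> / 2"
      using c by (simp add: \<theta>_def)
    finally have "\<bar>(s - conj q) * (u' - u)\<bar> \<le> \<delta> / 2" .
    moreover have "(s - conj q) * (u' - q) = (s - conj q) * (u - q) + (s - conj q) * (u' - u)"
      by (simp add: algebra_simps)
    ultimately show ?thesis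
      using inhom_min_le[OF q(1), of s u'] q(2) by linarith
  qed
  ultimately show ?thesis
    using that by blast
qed

lemma inhom_min_translate:
  assumes "q \<in> O_K"
  shows "inhom_min D (s + conj q, u + q) = inhom_min D (s, u)"
proof -
  have *: "inhom_min D (s + conj q, u + q) \<le> inhom_min D (s, u)" if "q \<in> O_K" for s u q
  proof (rule le_inhom_min)
    fix r assume "r \<in> O_K"
    then show "inhom_min D (s + conj q, u + q) \<le> \<bar>(s - conj r) * (u - r)\<bar>"
      using inhom_min_le[of "r + q" "s + conj q" "u + q"] that
      by (simp add: O_K_add conj_add O_K_in_K)
  qed
  show ?thesis
    using *[OF assms, of s u] *[OF O_K_uminus[OF assms], of "s + conj q" "u + q"] assms
    by (simp add: conj_uminus O_K_in_K)
qed

section \<open>Passage from the torus to the plane\<close>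

lemma int_lattice_iff: "(s, u) \<in> int_lattice D \<longleftrightarrow> u \<in> O_K \<and> s = conj u"
  unfolding int_lattice_def by auto

text \<open>Translation invariance makes \<open>inhom_min D\<close> constant on each class, so the
  remaining work can be done with points of the plane.\<close>

lemma inhom_spectrum_eq: "inhom_spectrum D = range (inhom_min D)"
proof -
  define E where "E = {(P, Q). P - Q \<in> int_lattice D}"
  have E_iff: "((s, u), (s', u')) \<in> E \<longleftrightarrow> u - u' \<in> O_K \<and> s - s' = conj (u - u')" for s u s' u'
    by (simp add: E_def int_lattice_iff)
  have "torus_min D (E `` {(s, u)}) = inhom_min D (s, u)" for s u
  proof -
    have *: "inhom_min D Q = inhom_min D (s, u)" if "((s, u), Q) \<in> E" for Q
    proof (cases Q)
      case (Pair s' u')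
      then have "u - u' \<in> O_K" and s: "conj (u - u') = s - s'"
        using that E_iff by auto
      then have "inhom_min D (s' + (s - s'), u' + (u - u')) = inhom_min D (s', u')"
        using inhom_min_translate[of "u - u'" s' u'] by (simp only: s)
      then show ?thesis
        using Pair by simp
    qed
    have "((s, u), (s, u)) \<in> E"
      using O_K_of_int[of 0] conj_Rats[of 0] by (simp add: E_iff)
    then have "(s, u) \<in> E `` {(s, u)}"
      by blast
    moreover have "inhom_min D Q = inhom_min D (s, u)" if "Q \<in> E `` {(s, u)}" for Q
      using that by (intro *) blast
    ultimately have "inhom_min D ` (E `` {(s, u)}) = {inhom_min D (s, u)}"
      by (intro equalityI image_subsetI singletonI subsetI) (metis singletonI, metis image_eqI singletonD)
    then show ?thesis
      unfolding torus_min_def by simp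
  qed
  then have "torus_min D (E `` {P}) = inhom_min D P" for P
    by (cases P) simp
  moreover have "quad_torus D = range (\<lambda>P. E `` {P})"
    unfolding quad_torus_def E_def[symmetric] quotient_def by blast
  ultimately show ?thesis
    unfolding inhom_spectrum_def by (simp add: image_image)
qed

text \<open>Points of Z[w] suffice: round down the coefficients \<alpha> and \<beta> of
  \<open>(s, u)\<close> in the basis \<open>1\<close>, \<open>w\<close>; the fractional parts give
  the bound \<open>1 + w\<close>.\<close>

lemma covering_radius:
  obtains q where "q \<in> O_K" "\<bar>s - conj q\<bar> \<le> 1 + w" "\<bar>u - q\<bar> \<le> 1 + w"
proof -
  define \<alpha> \<beta> where "\<alpha> = (s + u) / 2" and "\<beta> = (u - s) / (2 * w)"
  define q where "q = of_int \<lfloor>\<alpha>\<rfloor> + of_int \<lfloor>\<beta>\<rfloor> * w"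
  have "\<beta> * w = (u - s) / 2"
    using w_pos by (simp add: \<beta>_def)
  then have u: "u = \<alpha> + \<beta> * w" and s: "s = \<alpha> - \<beta> * w"
    unfolding \<alpha>_def by (simp_all add: field_simps)
  have q: "conj q = of_int \<lfloor>\<alpha>\<rfloor> - of_int \<lfloor>\<beta>\<rfloor> * w"
    unfolding q_def by (rule conj_eq) auto
  have "s - conj q = frac \<alpha> - frac \<beta> * w" "u - q = frac \<alpha> + frac \<beta> * w"
    unfolding q unfolding s u q_def frac_def by (simp_all only: algebra_simps)
  moreover have "frac \<beta> * w \<ge> 0" "frac \<beta> * w \<le> w"
    using w_pos frac_lt_1[of \<beta>] by (auto intro: mult_left_le_one_le)
  moreover have "0 \<le> frac \<alpha>" "frac \<alpha> < 1"
    by (simp_all add: frac_lt_1)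
  ultimately have "\<bar>s - conj q\<bar> \<le> 1 + w" "\<bar>u - q\<bar> \<le> 1 + w"
    by linarith+
  moreover have "q \<in> O_K"
    unfolding q_def by (intro Z_w_in_O_K Z_wI)
  ultimately show ?thesis
    using that by blast
qed

end

section \<open>The action of a unit on the torus\<close>

locale real_quadratic_unit = real_quadratic +
  fixes e :: real
  assumes e_gt_1: "e > 1" and e_in_O_K: "e \<in> O_K" and conj_e: "conj e = inverse e"
begin

section \<open>Powers of the unit and rescaling\<close>

lemma e_powi_pos [simp]: "e powi n > 0"
  using e_gt_1 by (simp add: zero_less_power_int)

lemma e_powi_nonneg [simp]: "e powi n \<ge> 0"
  by (simp add: less_imp_le)

lemma e_powi_add: "e powi (m + n) = e powi m * e powi n"
  using e_gt_1 by (intro power_int_add) auto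

lemma e_powi_mono: "m \<le> n \<Longrightarrow> e powi m \<le> e powi n"
  using e_gt_1 by (intro power_int_increasing) auto

lemma e_powi_cancel: "e powi (- n) * (e powi n * x) = x" "e powi n * (e powi (- n) * x) = x"
  using e_gt_1 by (simp_all add: power_int_minus)

lemma e_powi_in_O_K: "e powi n \<in> O_K"
  and conj_e_powi: "conj (e powi n) = e powi (- n)"
proof -
  have "e powi n \<in> O_K \<and> conj (e powi n) = e powi (- n)"
  proof (cases "n \<ge> 0")
    case True
    then show ?thesis
      using e_in_O_K conj_e
      by (simp add: power_int_def O_K_power conj_power O_K_in_K power_inverse)
  next
    case False
    have inv: "inverse e \<in> O_K" "conj (inverse e) = e"
      using O_K_conj[OF e_in_O_K] conj_conj[OF O_K_in_K[OF e_in_O_K]] by (simp_all add: conj_e)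
    then show ?thesis
      using False by (simp add: power_int_def O_K_power conj_power O_K_in_K)
  qed
  then show "e powi n \<in> O_K" "conj (e powi n) = e powi (- n)"
    by auto
qed

lemma abs_mult_rescale: "\<bar>(e powi (- n) * a) * (e powi n * b)\<bar> = \<bar>a * b\<bar>"
proof -
  have "(e powi (- n) * a) * (e powi n * b) = e powi (- n) * (e powi n * (a * b))"
    by (simp only: ac_simps)
  also have "\<dots> = a * b"
    by (rule e_powi_cancel)
  finally show ?thesis
    by (simp only:)
qed

text \<open>The region of bounded norm is unbounded, but powers of the unit move each of its points
  into a fixed box.\<close>

lemma balance:
  assumes "\<bar>s * u\<bar> \<le> C"
  obtains n where "\<bar>e powi (- n) * s\<bar> \<le> C + e" "\<bar>e powi n * u\<bar> \<le> C + e"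
proof (cases "u = 0")
  case True
  \<comment> \<open>With \<open>u = 0\<close> it is enough to contract \<open>s\<close> to size
    1.\<close>
  obtain N where N: "\<bar>s\<bar> < e ^ N"
    using real_arch_pow[OF e_gt_1] by blast
  have "\<bar>e powi (- int N) * s\<bar> \<le> e powi (- int N) * (e powi int N)"
    unfolding abs_mult using N by (intro mult_mono) auto
  also have "\<dots> = 1"
    using e_powi_cancel(1)[of "int N" 1] by simp
  finally have "\<bar>e powi (- int N) * s\<bar> \<le> C + e"
    using e_gt_1 assms by linarith
  then show ?thesis
    using that[of "int N"] True assms e_gt_1 by simp
next
  case False
  \<comment> \<open>Scaling by \<open>e powi (- m)\<close> brings \<open>\<bar>u\<bar>\<close> into
    \<open>[1, e)\<close>; the other coordinate is then at most the product, hence at most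
    \<open>C\<close>.\<close>
  define m where "m = \<lfloor>log e \<bar>u\<bar>\<rfloor>"
  have m: "e powi m \<le> \<bar>u\<bar>" "\<bar>u\<bar> < e powi (m + 1)"
    unfolding m_def using powi_floor_log[OF e_gt_1, of "\<bar>u\<bar>"] False by auto
  have "e powi m * \<bar>s\<bar> \<le> \<bar>u\<bar> * \<bar>s\<bar>"
    using m by (intro mult_right_mono) auto
  also have "\<dots> \<le> C"
    using assms by (simp add: abs_mult mult.commute)
  finally have 1: "\<bar>e powi (- (- m)) * s\<bar> \<le> C + e"
    using e_gt_1 by (simp add: abs_mult)
  have "\<bar>e powi (- m) * u\<bar> \<le> e powi (- m) * (e powi m * e)"
    unfolding abs_mult using m(2) e_gt_1 by (intro mult_mono) (auto simp: e_powi_add)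
  then have 2: "\<bar>e powi (- m) * u\<bar> \<le> C + e"
    unfolding e_powi_cancel using assms by linarith
  show ?thesis
    using that[OF 1 2] .
qed

section \<open>Shadowing and close returns\<close>

text \<open>Only lattice points \<open>q\<close> of value at most \<open>C\<close> need attention.
  After balancing, their two factors lie in the box of size \<open>C + e\<close>; passing to the
  shadowed orbit changes each factor by at most \<eta>, and \<open>abs_mult_perturb\<close> bounds
  the change of the product.\<close>

lemma shadowing_lower_bound:
  assumes "\<eta> \<ge> 0"
    and shadow: "\<And>n. \<exists>n'. \<exists>l\<in>O_K. \<bar>e powi (- n) * s' - e powi (- n') * s - conj l\<bar> \<le> \<eta> \<and>
      \<bar>e powi n * u' - e powi n' * u - l\<bar> \<le> \<eta>"
  shows "inhom_min D (s, u) - (2 * (inhom_min D (s, u) + e) * \<eta> + \<eta>\<^sup>2) \<le> inhom_min D (s', u')"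
proof (rule le_inhom_min)
  fix q assume q: "q \<in> O_K"
  define C where "C = inhom_min D (s, u)"
  have C: "C \<ge> 0"
    unfolding C_def by (rule inhom_min_nonneg)
  show "C - (2 * (C + e) * \<eta> + \<eta>\<^sup>2) \<le> \<bar>(s' - conj q) * (u' - q)\<bar>"
  proof (cases "\<bar>(s' - conj q) * (u' - q)\<bar> \<le> C")
    case False
    moreover have "2 * (C + e) * \<eta> + \<eta>\<^sup>2 \<ge> 0"
      using C e_gt_1 assms(1) by simp
    ultimately show ?thesis
      by linarith
  next
    case True
    obtain n where n: "\<bar>e powi (- n) * (s' - conj q)\<bar> \<le> C + e" "\<bar>e powi n * (u' - q)\<bar> \<le> C + e"
      using balance[OF True] by blast
    obtain n' l where l: "l \<in> O_K"
      and s: "\<bar>e powi (- n) * s' - e powi (- n') * s - conj l\<bar> \<le> \<eta>"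
      and u: "\<bar>e powi n * u' - e powi n' * u - l\<bar> \<le> \<eta>"
      using shadow by blast
    \<comment> \<open>The point \<open>q\<close> is carried to time \<open>n\<close>, shifted by
      \<open>l\<close> onto the orbit of \<open>(s, u)\<close>, and carried back from time
      \<open>n'\<close>.\<close>
    define r where "r = e powi (- n') * (e powi n * q - l)"
    have r: "r \<in> O_K"
      unfolding r_def using q l by (intro O_K_mult O_K_diff e_powi_in_O_K)
    have "conj r = conj (e powi (- n')) * (conj (e powi n) * conj q - conj l)"
      unfolding r_def using q l
      by (simp add: conj_mult conj_diff O_K_in_K O_K_mult O_K_diff e_powi_in_O_K)
    then have conj_r: "conj r = e powi n' * (e powi (- n) * conj q - conj l)"
      by (simp add: conj_e_powi)
    have "e powi (- n) * (s' - conj q) - e powi (- n') * (s - conj r) =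
        e powi (- n) * s' - e powi (- n') * s - conj l"
      unfolding conj_r right_diff_distrib e_powi_cancel by simp
    moreover have "e powi n * (u' - q) - e powi n' * (u - r) = e powi n * u' - e powi n' * u - l"
      unfolding r_def right_diff_distrib e_powi_cancel by simp
    ultimately have "\<bar>(e powi (- n') * (s - conj r)) * (e powi n' * (u - r))\<bar> \<le>
        \<bar>(e powi (- n) * (s' - conj q)) * (e powi n * (u' - q))\<bar> + (2 * (C + e) * \<eta> + \<eta>\<^sup>2)"
      using n s u by (intro abs_mult_perturb) auto
    then have "\<bar>(s - conj r) * (u - r)\<bar> \<le>
        \<bar>(s' - conj q) * (u' - q)\<bar> + (2 * (C + e) * \<eta> + \<eta>\<^sup>2)"
      unfolding abs_mult_rescale .
    then show ?thesis
      using inhom_min_le[OF r, of s u] unfolding C_def by linarith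
  qed
qed

text \<open>Compactness of the torus: representatives of the forward orbit in a bounded box have a
  convergent subsequence, and two of its late terms are close. The difference of their lattice
  points is \<open>l\<close>.\<close>

lemma close_return:
  assumes "\<eta> > 0"
  obtains n k :: nat and l where "k > 0" "l \<in> O_K"
    "\<bar>e powi (- (int n + int k)) * s - e powi (- int n) * s - conj l\<bar> \<le> \<eta>"
    "\<bar>e powi (int n + int k) * u - e powi (int n) * u - l\<bar> \<le> \<eta>"
proof -
  have "\<forall>n::nat. \<exists>q. q \<in> O_K \<and> \<bar>e powi (- int n) * s - conj q\<bar> \<le> 1 + w \<and>
      \<bar>e powi (int n) * u - q\<bar> \<le> 1 + w"
    by (meson covering_radius)
  then obtain q where q: "\<And>n::nat. q n \<in> O_K"
    "\<And>n. \<bar>e powi (- int n) * s - conj (q n)\<bar> \<le> 1 + w" "\<And>n. \<bar>e powi (int n) * u - q n\<bar> \<le> 1 + w"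
    by metis
  define f where "f n = (e powi (- int n) * s - conj (q n), e powi (int n) * u - q n)" for n
  have "bounded (range f)"
    using q by (intro bounded_subset[OF bounded_Times[OF bounded_cball bounded_cball, of 0 "1 + w" 0 "1 + w"]])
      (auto simp: f_def)
  then obtain x r where r: "strict_mono (r :: nat \<Rightarrow> nat)" and "(f \<circ> r) \<longlonglongrightarrow> x"
    using bounded_imp_convergent_subsequence by blast
  then have "Cauchy (f \<circ> r)"
    by (intro convergent_Cauchy) (metis convergent_def)
  then obtain N where N: "\<And>i j. i \<ge> N \<Longrightarrow> j \<ge> N \<Longrightarrow> dist ((f \<circ> r) i) ((f \<circ> r) j) < \<eta>"
    unfolding Cauchy_def using assms by meson
  define n where "n = r N"
  define k where "k = r (Suc N) - r N"
  have "r N < r (Suc N)"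
    using r by (simp add: strict_mono_def)
  then have k: "k > 0" "r (Suc N) = n + k"
    by (auto simp: n_def k_def)
  have "dist (f (n + k)) (f n) \<le> \<eta>"
    using N[of "Suc N" N] k by (simp add: n_def)
  then have "dist (fst (f (n + k))) (fst (f n)) \<le> \<eta>" "dist (snd (f (n + k))) (snd (f n)) \<le> \<eta>"
    using dist_fst_le dist_snd_le order_trans by blast+
  then have "\<bar>(e powi (- (int n + int k)) * s - conj (q (n + k))) - (e powi (- int n) * s - conj (q n))\<bar> \<le> \<eta>"
    "\<bar>(e powi (int n + int k) * u - q (n + k)) - (e powi (int n) * u - q n)\<bar> \<le> \<eta>"
    by (simp_all only: f_def fst_conv snd_conv dist_real_def of_nat_add)
  moreover have "conj (q (n + k) - q n) = conj (q (n + k)) - conj (q n)"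
    using q by (simp add: conj_diff O_K_in_K)
  ultimately show ?thesis
    using that[of k "q (n + k) - q n" n] k q by (simp add: O_K_diff algebra_simps)
qed

text \<open>If \<open>u\<close> returns exactly after \<open>k\<close> steps, then the errors of the successive returns of \<open>s\<close> form
  a geometric series.\<close>

lemma orbit_iterate:
  fixes n :: int and k r j :: nat
  assumes "k > 0" "l \<in> O_K" "\<eta> \<ge> 0"
    and s: "\<bar>e powi (- (n + int k)) * s - e powi (- n) * s - conj l\<bar> \<le> \<eta>"
    and u: "e powi (n + int k) * u - e powi n * u = l"
  shows "\<exists>m\<in>O_K. e powi (n + int r + int j * int k) * u - e powi (n + int r) * u = m \<and>
    \<bar>e powi (- (n + int r + int j * int k)) * s - e powi (- (n + int r)) * s - conj m\<bar>
      \<le> e / (e - 1) * \<eta> * (1 - (1 / e) ^ j)"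
proof (induction j)
  case 0
  show ?case
    using O_K_of_int[of 0] conj_Rats[of 0] by (intro bexI[of _ 0]) auto
next
  case (Suc j)
  define t where "t = int r + int j * int k"
  obtain m where m: "m \<in> O_K" "e powi (n + t) * u - e powi (n + int r) * u = m"
    "\<bar>e powi (- (n + t)) * s - e powi (- (n + int r)) * s - conj m\<bar> \<le> e / (e - 1) * \<eta> * (1 - (1 / e) ^ j)"
    using Suc by (auto simp: t_def add.assoc)
  \<comment> \<open>The lattice vector of the new round is \<open>l\<close> moved by
    \<open>t\<close> steps; it is added to the total so far.\<close>
  define m' where "m' = m + e powi t * l"
  have m': "m' \<in> O_K"
    unfolding m'_def using m assms by (intro O_K_add O_K_mult e_powi_in_O_K)
  have conj_m': "conj m' = conj m + e powi (- t) * conj l"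
    unfolding m'_def using m assms
    by (simp add: conj_add conj_mult conj_e_powi O_K_in_K O_K_mult e_powi_in_O_K)
  have t': "n + int r + int (Suc j) * int k = t + (n + int k)"
    by (simp add: t_def algebra_simps)
  have "e powi (t + (n + int k)) * u - e powi (n + int r) * u =
      e powi t * (e powi (n + int k) * u - e powi n * u) + (e powi (n + t) * u - e powi (n + int r) * u)"
    unfolding add.commute[of n t] e_powi_add by (simp add: algebra_simps)
  then have 1: "e powi (t + (n + int k)) * u - e powi (n + int r) * u = m'"
    unfolding u m(2) m'_def by simp
  have neg: "- (t + (n + int k)) = - t + - (n + int k)" "- (n + t) = - t + - n"
    by simp_all
  have "e powi (- (t + (n + int k))) * s - e powi (- (n + int r)) * s - conj m' =
      e powi (- t) * (e powi (- (n + int k)) * s - e powi (- n) * s - conj l) +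
      (e powi (- (n + t)) * s - e powi (- (n + int r)) * s - conj m)"
    unfolding conj_m' neg e_powi_add by (simp only: algebra_simps)
  moreover have "\<bar>e powi (- t) * (e powi (- (n + int k)) * s - e powi (- n) * s - conj l)\<bar>
      \<le> (1 / e) ^ j * \<eta>"
  proof -
    \<comment> \<open>Each round lasts \<open>k \<ge> 1\<close> steps, so after \<open>j\<close>
      rounds the error in \<open>s\<close> has contracted by a factor of at least
      \<open>e ^ j\<close>.\<close>
    have "int j \<le> t"
      unfolding t_def using assms(1) by (simp add: le_add1 trans_le_add2 flip: of_nat_mult of_nat_add)
    then have "e powi (- t) \<le> e powi (- int j)"
      by (intro e_powi_mono) simp
    also have "\<dots> = (1 / e) ^ j"
      by (simp add: power_int_minus inverse_eq_divide power_one_over)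
    finally show ?thesis
      unfolding abs_mult using s e_gt_1 by (intro mult_mono) auto
  qed
  ultimately have "\<bar>e powi (- (t + (n + int k))) * s - e powi (- (n + int r)) * s - conj m'\<bar>
      \<le> (1 / e) ^ j * \<eta> + e / (e - 1) * \<eta> * (1 - (1 / e) ^ j)"
    using m(3) by linarith
  also have "\<dots> = e / (e - 1) * \<eta> * (1 - (1 / e) ^ Suc j)"
  proof -
    have "x * \<eta> + e / (e - 1) * \<eta> * (1 - x) = e / (e - 1) * \<eta> * (1 - 1 / e * x)" for x
      using e_gt_1 by (simp add: field_simps)
    then show ?thesis
      by simp
  qed
  finally show ?case
    unfolding t' using 1 m' by blast
qed

text \<open>Upper semicontinuity gives the upper estimate for any \<open>u'\<close> close to
  \<open>u\<close>; shadowing gives the lower one for the \<open>u'\<close> that makes the return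
  exact.\<close>

lemma perturb_second_coordinate:
  assumes "\<delta> > 0"
  obtains u' where "u' \<in> K" "\<bar>inhom_min D (s, u') - inhom_min D (s, u)\<bar> < \<delta>"
proof -
  obtain \<theta> where \<theta>: "\<theta> > 0"
    "\<And>u'. \<bar>u' - u\<bar> < \<theta> \<Longrightarrow> inhom_min D (s, u') < inhom_min D (s, u) + \<delta>"
    using inhom_min_upper_semicontinuous[OF assms] by metis
  define R where "R = inhom_min D (s, u) + e"
  have R: "R > 1"
    using inhom_min_nonneg[of s u] e_gt_1 by (simp add: R_def)
  define c where "c = e / (e - 1)"
  have c: "c > 0"
    using e_gt_1 by (simp add: c_def)
  \<comment> \<open>The three bounds give \<open>H\<^sup>2 \<le> H\<close>, admit \<open>u'\<close>
    to the semicontinuity neighbourhood, and bound the shadowing loss by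
    \<open>\<delta> / 2\<close>.\<close>
  define H where "H = Min {1, \<theta> / 2, \<delta> / 2 / (2 * R + 1)}"
  have H: "H > 0" "H \<le> 1" "H < \<theta>" "H \<le> \<delta> / 2 / (2 * R + 1)"
    using R assms \<theta>(1) by (auto simp: H_def min_less_iff_disj)
  have "2 * R * H + H\<^sup>2 \<le> 2 * R * H + H"
    using H by (simp add: power2_eq_square mult_left_le)
  also have "\<dots> = (2 * R + 1) * H"
    by (simp add: algebra_simps)
  also have "\<dots> \<le> \<delta> / 2"
    using pos_le_divide_eq[of "2 * R + 1" H "\<delta> / 2"] H(4) R by (simp only: mult.commute)
  also have "\<dots> < \<delta>"
    using assms by simp
  finally have H_small: "2 * R * H + H\<^sup>2 < \<delta>" .
  \<comment> \<open>The factor \<open>c\<close> is lost once in each coordinate: in the geometric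
    series for \<open>s\<close>, and in comparing \<Delta> with
    \<open>e powi (int n + int k)\<close> for \<open>u\<close>.\<close>
  define \<eta> where "\<eta> = H / c"
  have \<eta>: "\<eta> > 0" "c * \<eta> = H"
    using H c by (auto simp: \<eta>_def)
  obtain n k :: nat and l where k: "k > 0" and l: "l \<in> O_K"
    and ret_s: "\<bar>e powi (- (int n + int k)) * s - e powi (- int n) * s - conj l\<bar> \<le> \<eta>"
    and ret_u: "\<bar>e powi (int n + int k) * u - e powi (int n) * u - l\<bar> \<le> \<eta>"
    using close_return[OF \<eta>(1)] by metis
  define \<Delta> where "\<Delta> = e powi (int n + int k) - e powi (int n)"
  \<comment> \<open>The solution of \<open>\<Delta> * u' = l\<close>: the second coordinate returns
    exactly after \<open>k\<close> steps from time \<open>n\<close>.\<close>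
  define u' where "u' = l / \<Delta>"
  have ek: "e ^ k \<ge> e"
    using k e_gt_1 self_le_power[of e k] by simp
  have \<Delta>: "\<Delta> > 0"
    unfolding \<Delta>_def e_powi_add using ek e_gt_1 by simp
  have \<Delta>_lower: "e powi (int n + int k) \<le> c * \<Delta>"
  proof -
    have "e ^ k \<le> c * (e ^ k - 1)"
      unfolding c_def using ek e_gt_1 by (simp add: field_simps)
    then have "e powi int n * e ^ k \<le> e powi int n * (c * (e ^ k - 1))"
      using e_gt_1 by (intro mult_left_mono) auto
    then show ?thesis
      unfolding \<Delta>_def e_powi_add by (simp add: algebra_simps)
  qed
  have "u' \<in> K"
    unfolding u'_def \<Delta>_def using l by (intro K_divide K_diff O_K_in_K e_powi_in_O_K)
  have per: "e powi (int n + int k) * u' - e powi (int n) * u' = l"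
    unfolding left_diff_distrib[symmetric] \<Delta>_def[symmetric] u'_def using \<Delta> by simp
  have "\<Delta> * (u' - u) = - (e powi (int n + int k) * u - e powi (int n) * u - l)"
    unfolding \<Delta>_def using per by (simp add: algebra_simps)
  then have "\<bar>\<Delta> * (u' - u)\<bar> \<le> \<eta>"
    using ret_u by linarith
  then have "\<Delta> * \<bar>u' - u\<bar> \<le> \<eta>"
    using \<Delta> by (simp add: abs_mult)
  then have "c * (\<Delta> * \<bar>u' - u\<bar>) \<le> H"
    unfolding \<eta>(2)[symmetric] using c by (intro mult_left_mono) auto
  moreover have "e powi (int n + int k) * \<bar>u' - u\<bar> \<le> c * \<Delta> * \<bar>u' - u\<bar>"
    using \<Delta>_lower by (intro mult_right_mono) auto
  ultimately have last: "e powi (int n + int k) * \<bar>u' - u\<bar> \<le> H"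
    by (simp add: mult.assoc)
  \<comment> \<open>The gap in \<open>u\<close> grows with time, so its size at time
    \<open>n + k\<close> bounds it at all earlier times, negative ones included.\<close>
  have early: "\<bar>e powi i * u' - e powi i * u\<bar> \<le> H" if "i \<le> int n + int k" for i
  proof -
    have "\<bar>e powi i * u' - e powi i * u\<bar> = e powi i * \<bar>u' - u\<bar>"
      unfolding right_diff_distrib[symmetric] abs_mult by simp
    also have "\<dots> \<le> e powi (int n + int k) * \<bar>u' - u\<bar>"
      using that by (intro mult_right_mono e_powi_mono) auto
    finally show ?thesis
      using last by linarith
  qed
  have "\<bar>u' - u\<bar> \<le> H"
    using early[of 0] by simp
  then have "inhom_min D (s, u') < inhom_min D (s, u) + \<delta>"
    using \<theta>(2) H by simp
  moreover have "inhom_min D (s, u) - (2 * (inhom_min D (s, u) + e) * H + H\<^sup>2) \<le> inhom_min D (s, u')"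
  proof (rule shadowing_lower_bound)
    fix i :: int
    show "\<exists>i'. \<exists>l\<in>O_K. \<bar>e powi (- i) * s - e powi (- i') * s - conj l\<bar> \<le> H \<and>
      \<bar>e powi i * u' - e powi i' * u - l\<bar> \<le> H"
    proof (cases "i \<le> int n")
      case True
      then show ?thesis
        using early[of i] H O_K_of_int[of 0] conj_Rats[of 0]
        by (intro exI[of _ i] bexI[of _ 0]) auto
    next
      case False
      \<comment> \<open>Times after \<open>n\<close> are folded back to the first loop; the offset
        \<open>r < k\<close> keeps the comparison within the range of \<open>early\<close>.\<close>
      define r j where "r = nat (i - int n) mod k" and "j = nat (i - int n) div k"
      have "int (r + j * k) = i - int n"
        unfolding r_def j_def using False by simp
      then have i: "i = int n + int r + int j * int k"
        by simp
      have "r < k"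
        using k by (simp add: r_def)
      obtain m where m: "m \<in> O_K" "e powi i * u' - e powi (int n + int r) * u' = m"
        "\<bar>e powi (- i) * s - e powi (- (int n + int r)) * s - conj m\<bar> \<le> c * \<eta> * (1 - (1 / e) ^ j)"
        using orbit_iterate[OF k l _ ret_s per, of r j] \<eta>(1) unfolding i c_def by auto
      have "c * \<eta> * (1 - (1 / e) ^ j) \<le> H"
        unfolding \<eta>(2) using H e_gt_1 by (intro mult_left_le) auto
      moreover have "\<bar>e powi (int n + int r) * u' - e powi (int n + int r) * u\<bar> \<le> H"
        using \<open>r < k\<close> by (intro early) simp
      ultimately show ?thesis
        using m by (intro exI[of _ "int n + int r"] bexI[of _ m]) auto
    qed
  qed (use H in simp)
  ultimately have "\<bar>inhom_min D (s, u') - inhom_min D (s, u)\<bar> < \<delta>"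
    using H_small unfolding R_def by linarith
  then show ?thesis
    using that \<open>u' \<in> K\<close> by blast
qed

section \<open>Values at points with both coordinates in the field\<close>

text \<open>An unattained infimum forces near-optimal \<open>q\<close> out of every box, so their
  balancing exponents are unbounded. One factor is then so small that replacing \<open>s\<close> by
  \<open>conj u\<close>, or \<open>u\<close> by \<open>conj s\<close>, hardly changes the product
  and turns it into a norm with denominator \<open>d\<^sup>2\<close>.\<close>

lemma inhom_min_in_K:
  assumes "s \<in> K" "u \<in> K"
  shows "inhom_min D (s, u) \<in> K"
proof (cases "\<exists>q\<in>O_K. inhom_min D (s, u) = \<bar>(s - conj q) * (u - q)\<bar>")
  case True
  then show ?thesis
    using assms by (auto simp: O_K_in_K intro!: K_abs K_mult K_diff K_conj)
next
  case False
  define M where "M = inhom_min D (s, u)"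
  define R where "R = M + 1 + e"
  define f where "f q = \<bar>(s - conj q) * (u - q)\<bar>" for q
  have R: "R > 0"
    using inhom_min_nonneg[of s u] e_gt_1 by (simp add: R_def M_def)
  have f_gt: "f q > M" if "q \<in> O_K" for q
    using False inhom_min_le[OF that, of s u] that by (force simp: f_def M_def)
  obtain d1 d2 :: int where d12: "d1 > 0" "of_int d1 * s \<in> Z_w" "d2 > 0" "of_int d2 * u \<in> Z_w"
    using K_denominator assms by metis
  define d where "d = d1 * d2"
  have d: "d > 0" "of_int d * s \<in> O_K" "of_int d * u \<in> O_K"
  proof -
    show "d > 0"
      using d12 by (simp add: d_def)
    have "of_int d2 * (of_int d1 * s) \<in> O_K" "of_int d1 * (of_int d2 * u) \<in> O_K"
      using d12(2,4)[THEN Z_w_in_O_K] O_K_mult[OF O_K_of_int] by auto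
    then show "of_int d * s \<in> O_K" "of_int d * u \<in> O_K"
      by (simp_all add: d_def algebra_simps)
  qed
  have norm_int: "(of_int d)\<^sup>2 * \<bar>(x - q) * (conj x - conj q)\<bar> \<in> \<int>"
    if "x \<in> K" "of_int d * x \<in> O_K" "q \<in> O_K" for x q
  proof -
    have "of_int d * (x - q) \<in> O_K"
      using O_K_diff[OF that(2) O_K_mult[OF O_K_of_int that(3)], of d] by (simp add: algebra_simps)
    then have "of_int d * (x - q) * conj (of_int d * (x - q)) \<in> \<int>"
      using O_K_iff norm_in_Ints by blast
    moreover have "conj (of_int d * (x - q)) = of_int d * (conj x - conj q)"
      using that by (simp add: conj_mult conj_diff conj_Rats Rats_in_K K_diff O_K_in_K)
    ultimately have "of_int d * (x - q) * (of_int d * (conj x - conj q)) \<in> \<int>"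
      by (simp only:)
    moreover have "of_int d * (x - q) * (of_int d * (conj x - conj q)) =
        (of_int d)\<^sup>2 * ((x - q) * (conj x - conj q))"
      by (simp only: power2_eq_square ac_simps)
    ultimately have "(of_int d)\<^sup>2 * ((x - q) * (conj x - conj q)) \<in> \<int>"
      by (simp only:)
    then have "\<bar>(of_int d)\<^sup>2 * ((x - q) * (conj x - conj q))\<bar> \<in> \<int>"
      by (rule Ints_abs)
    then show ?thesis
      by (simp add: abs_mult)
  qed
  have approx: "\<exists>z\<in>\<int>. \<bar>z / (of_int d)\<^sup>2 - M\<bar> < \<delta>" if "\<delta> > 0" for \<delta>
  proof -
    define X where "X = (\<bar>s - conj u\<bar> + \<bar>u - conj s\<bar>) * R"
    have X: "X \<ge> 0" "\<bar>s - conj u\<bar> * R \<le> X" "\<bar>u - conj s\<bar> * R \<le> X"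
      using R by (auto simp: X_def intro!: mult_right_mono)
    obtain N where "2 * X / \<delta> < e ^ N"
      using real_arch_pow[OF e_gt_1] by blast
    then have N: "e powi (- int N) * X < \<delta> / 2"
      using that e_gt_1 by (simp add: power_int_minus field_simps)
    \<comment> \<open>Large enough that every \<open>q\<close> with balancing exponent between
      \<open>-N\<close> and \<open>N\<close> lies in \<open>F\<close>.\<close>
    define B where "B = \<bar>s\<bar> + \<bar>u\<bar> + e powi (int N) * R"
    define F where "F = {q \<in> O_K. \<bar>q\<bar> \<le> B \<and> \<bar>conj q\<bar> \<le> B}"
    \<comment> \<open>This threshold exceeds \<open>M\<close> because the infimum is not attained on
      the finite set \<open>F\<close>; a value below it can only come from outside
      \<open>F\<close>.\<close>
    define \<theta> where "\<theta> = Min (insert (M + min 1 (\<delta> / 2)) (f ` F))"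
    have fin: "finite F"
      unfolding F_def by (rule finite_O_K_box)
    have "\<theta> > M"
      unfolding \<theta>_def using fin f_gt that by (subst Min_gr_iff) (auto simp: F_def)
    then obtain q where q: "q \<in> O_K" "f q < \<theta>"
      unfolding M_def f_def using inhom_min_less by metis
    have fq: "f q < M + min 1 (\<delta> / 2)"
      using q(2) fin unfolding \<theta>_def by simp
    have "q \<notin> F"
      using q(2) fin unfolding \<theta>_def by auto
    have "\<bar>(s - conj q) * (u - q)\<bar> \<le> M + 1"
      using fq by (simp add: f_def)
    then obtain n where n: "\<bar>e powi (- n) * (s - conj q)\<bar> \<le> R" "\<bar>e powi n * (u - q)\<bar> \<le> R"
      unfolding R_def using balance by blast
    have "\<not> \<bar>n\<bar> \<le> int N"
    proof
      assume n_le: "\<bar>n\<bar> \<le> int N"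
      have "\<bar>s - conj q\<bar> = e powi n * \<bar>e powi (- n) * (s - conj q)\<bar>"
        using e_powi_cancel(2)[of n "\<bar>s - conj q\<bar>"] by (simp add: abs_mult)
      also have "\<dots> \<le> e powi (int N) * R"
        using n n_le e_gt_1 by (intro mult_mono e_powi_mono) auto
      finally have 1: "\<bar>s - conj q\<bar> \<le> e powi (int N) * R" .
      have "\<bar>u - q\<bar> = e powi (- n) * \<bar>e powi n * (u - q)\<bar>"
        using e_powi_cancel(1)[of n "\<bar>u - q\<bar>"] by (simp add: abs_mult)
      also have "\<dots> \<le> e powi (int N) * R"
        using n n_le e_gt_1 by (intro mult_mono e_powi_mono) auto
      finally have "q \<in> F"
        using 1 q(1) unfolding F_def B_def by auto
      then show False
        using \<open>q \<notin> F\<close> by blast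
    qed
    then consider "int N \<le> n" | "n \<le> - int N"
      by linarith
    then obtain z where z: "z \<in> \<int>" "\<bar>z / (of_int d)\<^sup>2 - f q\<bar> < \<delta> / 2"
    proof cases
      case 1
      \<comment> \<open>Here \<open>\<bar>u - q\<bar> \<le> e powi (- int N) * R\<close>, so
        \<open>s\<close> may be replaced by \<open>conj u\<close>; the product becomes the norm of
        \<open>u - q\<close>.\<close>
      define z where "z = (of_int d)\<^sup>2 * \<bar>(u - q) * (conj u - conj q)\<bar>"
      have "z \<in> \<int>"
        unfolding z_def using assms d q by (intro norm_int)
      have "z / (of_int d)\<^sup>2 = \<bar>(conj u - conj q) * (u - q)\<bar>"
        using d(1) by (simp add: z_def mult.commute)
      then have "\<bar>z / (of_int d)\<^sup>2 - f q\<bar> \<le> \<bar>(conj u - conj q) * (u - q) - (s - conj q) * (u - q)\<bar>"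
        unfolding f_def by linarith
      also have "\<dots> = \<bar>(s - conj u) * (u - q)\<bar>"
        unfolding left_diff_distrib[symmetric] abs_mult by (simp add: abs_minus_commute)
      also have "\<dots> = \<bar>(e powi (- n) * (s - conj u)) * (e powi n * (u - q))\<bar>"
        by (rule abs_mult_rescale[symmetric])
      also have "\<dots> \<le> (e powi (- int N) * \<bar>s - conj u\<bar>) * R"
        unfolding abs_mult using n 1 R
        by (intro mult_mono) (auto simp: abs_mult intro!: mult_right_mono e_powi_mono)
      also have "\<dots> \<le> e powi (- int N) * X"
        unfolding mult.assoc using X by (intro mult_left_mono) auto
      finally have "\<bar>z / (of_int d)\<^sup>2 - f q\<bar> < \<delta> / 2"
        using N by linarith
      then show ?thesis
        using that \<open>z \<in> \<int>\<close> by blast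
    next
      case 2
      \<comment> \<open>Here the small factor is \<open>s - conj q\<close>, so \<open>u\<close> is
        replaced by \<open>conj s\<close>; the norm is that of \<open>s - conj q\<close>.\<close>
      define z where "z = (of_int d)\<^sup>2 * \<bar>(s - conj q) * (conj s - conj (conj q))\<bar>"
      have "z \<in> \<int>"
        unfolding z_def using assms d q by (intro norm_int O_K_conj)
      have "z / (of_int d)\<^sup>2 = \<bar>(s - conj q) * (conj s - q)\<bar>"
        using d(1) q by (simp add: z_def conj_conj O_K_in_K)
      then have "\<bar>z / (of_int d)\<^sup>2 - f q\<bar> \<le> \<bar>(s - conj q) * (conj s - q) - (s - conj q) * (u - q)\<bar>"
        unfolding f_def by linarith
      also have "\<dots> = \<bar>(s - conj q) * (u - conj s)\<bar>"
        unfolding right_diff_distrib[symmetric] abs_mult by (simp add: abs_minus_commute)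
      also have "\<dots> = \<bar>(e powi (- n) * (s - conj q)) * (e powi n * (u - conj s))\<bar>"
        by (rule abs_mult_rescale[symmetric])
      also have "\<dots> \<le> R * (e powi (- int N) * \<bar>u - conj s\<bar>)"
        unfolding abs_mult using n 2 R
        by (intro mult_mono) (auto simp: abs_mult intro!: mult_right_mono e_powi_mono)
      also have "\<dots> = e powi (- int N) * (\<bar>u - conj s\<bar> * R)"
        by simp
      also have "\<dots> \<le> e powi (- int N) * X"
        using X by (intro mult_left_mono) auto
      finally have "\<bar>z / (of_int d)\<^sup>2 - f q\<bar> < \<delta> / 2"
        using N by linarith
      then show ?thesis
        using that \<open>z \<in> \<int>\<close> by blast
    qed
    then have "\<bar>z / (of_int d)\<^sup>2 - M\<bar> < \<delta>"
      using fq f_gt[OF q(1)] by linarith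
    then show ?thesis
      using z(1) by blast
  qed
  \<comment> \<open>The integers form a closed set, so this limit of integers is an integer and
    \<open>M\<close> is rational.\<close>
  have "(of_int d)\<^sup>2 * M \<in> closure \<int>"
    unfolding closure_approachable
  proof (intro allI impI)
    fix \<delta> :: real assume "\<delta> > 0"
    have d2: "(of_int d :: real)\<^sup>2 > 0"
      using d(1) by simp
    obtain z where z: "z \<in> \<int>" "\<bar>z / (of_int d)\<^sup>2 - M\<bar> < \<delta> / (of_int d)\<^sup>2"
      using approx[of "\<delta> / (of_int d)\<^sup>2"] \<open>\<delta> > 0\<close> d2 by auto
    have "z - (of_int d)\<^sup>2 * M = (of_int d)\<^sup>2 * (z / (of_int d)\<^sup>2 - M)"
      using d2 by (simp add: right_diff_distrib)
    then have "\<bar>z - (of_int d)\<^sup>2 * M\<bar> = \<bar>z / (of_int d)\<^sup>2 - M\<bar> * (of_int d)\<^sup>2"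
      by (simp add: abs_mult)
    also have "\<dots> < \<delta>"
      using z(2) d2 by (simp only: pos_less_divide_eq)
    finally show "\<exists>y\<in>\<int>. dist y ((of_int d)\<^sup>2 * M) < \<delta>"
      using z(1) by (auto simp: dist_real_def)
  qed
  then have "(of_int d)\<^sup>2 * M \<in> \<int>"
    by (simp add: closure_closed)
  then have "(of_int d)\<^sup>2 * M / (of_int d)\<^sup>2 \<in> \<rat>"
    using Ints_subset_Rats by (intro Rats_divide) auto
  then show ?thesis
    using d(1) Rats_in_K by (simp add: M_def)
qed

text \<open>The coordinates are moved into \<open>K\<close> in turn, \<open>s\<close> by way of
  \<open>inhom_min_swap\<close>, at a cost of less than \<open>\<delta> / 2\<close> each.\<close>

lemma inhom_min_approx_in_K:
  assumes "\<delta> > 0"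
  obtains P where "inhom_min D P \<in> K" "\<bar>inhom_min D P - inhom_min D (s, u)\<bar> < \<delta>"
proof -
  obtain u' where u': "u' \<in> K" "\<bar>inhom_min D (s, u') - inhom_min D (s, u)\<bar> < \<delta> / 2"
    using perturb_second_coordinate[of "\<delta> / 2" s u] assms by auto
  obtain s' where s': "s' \<in> K" "\<bar>inhom_min D (u', s') - inhom_min D (u', s)\<bar> < \<delta> / 2"
    using perturb_second_coordinate[of "\<delta> / 2" u' s] assms by auto
  have "\<bar>inhom_min D (s', u') - inhom_min D (s, u)\<bar> < \<delta>"
    using u' s' inhom_min_swap[of u' s'] inhom_min_swap[of u' s] by linarith
  then show ?thesis
    using that inhom_min_in_K[OF s'(1) u'(1)] by blast
qed

end

theorem theorem1:
  fixes D :: int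
  assumes "D > 1" and "squarefree D"
  shows "inhom_spectrum D \<subseteq> closure (inhom_spectrum D \<inter> quad_field D)"
proof -
  interpret real_quadratic D
    using assms sqrt_squarefree_irrational by unfold_locales auto
  obtain e where "e > 1" "e \<in> O_K" "conj e = inverse e"
    using ex_unit by blast
  then interpret real_quadratic_unit D e
    by unfold_locales
  show ?thesis
  proof
    fix x assume "x \<in> inhom_spectrum D"
    then obtain s u where x: "x = inhom_min D (s, u)"
      unfolding inhom_spectrum_eq by auto
    show "x \<in> closure (inhom_spectrum D \<inter> quad_field D)"
      unfolding closure_approachable x inhom_spectrum_eq dist_real_def
      using inhom_min_approx_in_K[of _ s u] by (metis IntI rangeI)
  qed
qed

end
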